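(* Let $G$ be a finite pruned graph. Then $\mathrm{cat}(G)=2$ if and only if $G\cong C_3$, $G\cong P_3$, or $G\cong P_4$.
   Context: Cat Herding is played on a simple graph $G$. The cat first places its token on a vertex. Then the players alternate, the herder moving first: the herder deletes one edge of the current graph, and then, unless the cat's current vertex has degree $0$ in the current graph, the cat moves its token along a path with at least one edge in the current graph to a different vertex. The cat is captured when its vertex has degree $0$ in the current graph, and the game ends; the score is the number of edges deleted. For a finite graph $G$ and $v\in V(G)$, $\mathrm{cat}(G,v)$ is the score under optimal play (herder minimizing, cat maximizing) when the cat starts at $v$, and $\mathrm{cat}(G)=\max_{v}\mathrm{cat}(G,v)$. $P_n$ denotes the path on $n$ vertices and $C_n$ the cycle on $n$ vertices. A pruned graph is a connected graph containing no configuration $x\sim y\sim z$ with $x\neq z$, $\deg(x)=\deg(z)=1$ and $\deg(y)\ge 3$ (i.e. every vertex of degree at least $3$ is adjacent to at most one leaf). *)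

theory Defs
  imports Main
begin

text \<open>Simple graphs: a vertex set V and a set E of 2-element subsets of V.\<close>

definition simple_graph :: "'a set \<Rightarrow> 'a set set \<Rightarrow> bool" where
  "simple_graph V E \<longleftrightarrow> (\<forall>e\<in>E. \<exists>x y. x \<noteq> y \<and> x \<in> V \<and> y \<in> V \<and> e = {x, y})"

definition adj :: "'a set set \<Rightarrow> ('a \<times> 'a) set" where
  "adj E = {(x, y). {x, y} \<in> E \<and> x \<noteq> y}"

definition degree :: "'a set set \<Rightarrow> 'a \<Rightarrow> nat" where
  "degree E v = card {e \<in> E. v \<in> e}"

definition connected_graph :: "'a set \<Rightarrow> 'a set set \<Rightarrow> bool" where
  "connected_graph V E \<longleftrightarrow> V \<noteq> {} \<and> (\<forall>x\<in>V. \<forall>y\<in>V. (x, y) \<in> (adj E)\<^sup>*)"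

text \<open>Pruned: connected, and no x ~ y ~ z with x, z distinct leaves and deg y >= 3.\<close>
definition pruned :: "'a set \<Rightarrow> 'a set set \<Rightarrow> bool" where
  "pruned V E \<longleftrightarrow> connected_graph V E \<and>
     \<not> (\<exists>x y z. x \<in> V \<and> y \<in> V \<and> z \<in> V \<and> x \<noteq> z \<and> {x, y} \<in> E \<and> {y, z} \<in> E \<and>
            degree E x = 1 \<and> degree E z = 1 \<and> degree E y \<ge> 3)"

text \<open>Value of the Cat Herding game (herder minimizing, cat maximizing) from the
  position: current edge set E, cat at v, herder to move. The fuel argument n only
  bounds the recursion depth; since every round deletes one edge, fuel card E suffices.
  A round: the herder deletes e; if v is isolated in E - {e} the game ends, otherwise
  the cat moves to any vertex w \<noteq> v reachable from v in E - {e}.\<close>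
primrec cat_fuel :: "nat \<Rightarrow> 'a set set \<Rightarrow> 'a \<Rightarrow> nat" where
  "cat_fuel 0 E v = 0"
| "cat_fuel (Suc n) E v =
     (if \<not> (\<exists>e\<in>E. v \<in> e) then 0
      else Min ((\<lambda>e. Suc (if \<not> (\<exists>e'\<in>E - {e}. v \<in> e') then 0
                         else Max ((\<lambda>w. cat_fuel n (E - {e}) w) `
                                    {w. w \<noteq> v \<and> (v, w) \<in> (adj (E - {e}))\<^sup>*}))) ` E))"

text \<open>cat(G, v)\<close>
definition cat_vertex :: "'a set set \<Rightarrow> 'a \<Rightarrow> nat" where
  "cat_vertex E v = cat_fuel (card E) E v"

text \<open>cat(G) = max over starting vertices\<close>
definition cat_number :: "'a set \<Rightarrow> 'a set set \<Rightarrow> nat" where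
  "cat_number V E = Max ((\<lambda>v. cat_vertex E v) ` V)"

definition graph_iso :: "'a set \<Rightarrow> 'a set set \<Rightarrow> 'b set \<Rightarrow> 'b set set \<Rightarrow> bool" where
  "graph_iso V E V' E' \<longleftrightarrow> (\<exists>f. bij_betw f V V' \<and>
      (\<forall>x\<in>V. \<forall>y\<in>V. {x, y} \<in> E \<longleftrightarrow> {f x, f y} \<in> E'))"

text \<open>Path P_n and cycle C_n on vertex set {0..<n}.\<close>
definition path_V :: "nat \<Rightarrow> nat set" where "path_V n = {0..<n}"
definition path_E :: "nat \<Rightarrow> nat set set" where
  "path_E n = {{i, i + 1} | i. i + 1 < n}"
definition cycle_V :: "nat \<Rightarrow> nat set" where "cycle_V n = {0..<n}"
definition cycle_E :: "nat \<Rightarrow> nat set set" where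
  "cycle_E n = {{i, (i + 1) mod n} | i. i < n}"

end

theory Submission
  imports Defs
begin

text \<open>A vertex \<open>v\<close> has game value at most 2 iff it is isolated or the herder can delete an edge so
  that the component of \<open>v\<close> becomes a star centred at \<open>v\<close>, i.e. every neighbour \<open>w\<close> of \<open>v\<close> has
  \<open>v\<close> as its only neighbour. If this holds at every vertex of a pruned graph, no vertex has three
  neighbours; starting from a vertex with two neighbours, the star condition at it and at one of
  its neighbours leaves only the three listed graphs.\<close>

section \<open>Simple graphs and reachability\<close>

lemma simple_graph_edgeD:
  assumes "simple_graph V E" and "{x, y} \<in> E"
  shows "x \<noteq> y" "x \<in> V" "y \<in> V"
  using assms unfolding simple_graph_def by (metis doubleton_eq_iff)+

lemma simple_graph_incident:
  assumes "simple_graph V E" and "e \<in> E" and "v \<in> e"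
  obtains w where "e = {v, w}"
  using assms unfolding simple_graph_def by (metis doubleton_eq_iff insert_iff singletonD)

lemma simple_graph_Diff: "simple_graph V E \<Longrightarrow> simple_graph V (E - F)"
  unfolding simple_graph_def by blast

lemma simple_graph_finite_edges: "simple_graph V E \<Longrightarrow> finite V \<Longrightarrow> finite E"
  by (rule finite_subset[of _ "Pow V"]) (auto simp: simple_graph_def)

lemma adj_iff: "simple_graph V E \<Longrightarrow> (x, y) \<in> adj E \<longleftrightarrow> {x, y} \<in> E"
  unfolding adj_def using simple_graph_edgeD(1) by fastforce

text \<open>Makes the cat's set of moves finite, so that \<open>Max\<close> over it behaves well.
  The \<open>insert v\<close> covers the trivial walk, since \<open>v\<close> is not assumed to lie
  in \<open>V\<close>.\<close>

lemma adj_rtrancl_subset: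
  assumes "simple_graph V E"
  shows "{w. (v, w) \<in> (adj E)\<^sup>*} \<subseteq> insert v V"
proof
  fix w assume "w \<in> {w. (v, w) \<in> (adj E)\<^sup>*}"
  then have "(v, w) \<in> (adj E)\<^sup>*" by simp
  then show "w \<in> insert v V"
    by (cases rule: rtranclE) (use assms in \<open>auto simp: adj_iff dest: simple_graph_edgeD\<close>)
qed

lemma reachable_not_isolated:
  assumes "(v, w) \<in> (adj E)\<^sup>*" and "w \<noteq> v"
  shows "\<exists>e\<in>E. w \<in> e" "\<exists>e\<in>E. v \<in> e"
proof -
  show "\<exists>e\<in>E. w \<in> e"
    using assms by (cases rule: rtranclE) (auto simp: adj_def)
  show "\<exists>e\<in>E. v \<in> e"
    using assms by (cases rule: converse_rtranclE) (auto simp: adj_def)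
qed

section \<open>Game positions of value at most 0, 1 and 2\<close>

text \<open>A bound on \<open>Min\<close> is a choice of the herder, and a bound on
  \<open>Max\<close> is a demand on every reply of the cat. Immediate capture needs no clause of its
  own: the cat then has no reply and the demand is vacuous.\<close>

lemma cat_fuel_Suc_le_Suc_iff:
  assumes V: "finite V" and G: "simple_graph V E"
  shows "cat_fuel (Suc n) E v \<le> Suc k \<longleftrightarrow>
    \<not> (\<exists>e\<in>E. v \<in> e) \<or>
    (\<exists>e\<in>E. \<forall>w. w \<noteq> v \<and> (v, w) \<in> (adj (E - {e}))\<^sup>* \<longrightarrow> cat_fuel n (E - {e}) w \<le> k)"
proof (cases "\<exists>e\<in>E. v \<in> e")
  case False
  then show ?thesis by simp
next
  case True
  define R where "R e = {w. w \<noteq> v \<and> (v, w) \<in> (adj (E - {e}))\<^sup>*}" for e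
  define F where "F e = Suc (if \<not> (\<exists>e'\<in>E - {e}. v \<in> e') then 0
     else Max ((\<lambda>w. cat_fuel n (E - {e}) w) ` R e))" for e
  have fE: "finite E" and neE: "E \<noteq> {}"
    using simple_graph_finite_edges[OF G V] True by auto
  \<comment> \<open>If \<open>v\<close> becomes isolated, then \<open>F e\<close> is 1 and
    \<open>R e\<close> is empty, so both sides hold. Otherwise \<open>R e\<close> is finite and
    nonempty, and the bound passes through \<open>Max\<close>.\<close>
  have F_le: "F e \<le> Suc k \<longleftrightarrow> (\<forall>w\<in>R e. cat_fuel n (E - {e}) w \<le> k)" for e
  proof (cases "\<exists>e'\<in>E - {e}. v \<in> e'")
    case False
    then have "R e = {}"
      unfolding R_def using reachable_not_isolated(2) by fastforce
    then show ?thesis using False by (simp add: F_def)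
  next
    case True
    have G': "simple_graph V (E - {e})"
      using G by (rule simple_graph_Diff)
    obtain w where "{v, w} \<in> E - {e}"
      using True simple_graph_incident[OF G'] by metis
    then have "w \<in> R e"
      unfolding R_def using adj_iff[OF G'] simple_graph_edgeD(1)[OF G'] by auto
    moreover have "R e \<subseteq> insert v V"
      using adj_rtrancl_subset[OF G', of v] unfolding R_def by blast
    then have "finite (R e)"
      using V by (simp add: finite_subset)
    moreover have "F e = Suc (Max ((\<lambda>w. cat_fuel n (E - {e}) w) ` R e))"
      unfolding F_def using True by simp
    moreover from \<open>w \<in> R e\<close> have "R e \<noteq> {}" by blast
    ultimately show ?thesis by simp
  qed
  have "cat_fuel (Suc n) E v = Min (F ` E)"
    unfolding F_def R_def using True by simp
  then have "cat_fuel (Suc n) E v \<le> Suc k \<longleftrightarrow> (\<exists>e\<in>E. F e \<le> Suc k)"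
    using fE neE by (simp add: Min_le_iff)
  then show ?thesis
    using True unfolding F_le R_def by blast
qed

text \<open>A cat that is not isolated costs at least one deletion. The bound on
  \<open>card E\<close> ensures that the default value at fuel 0 is only met when \<open>E\<close>
  is empty.\<close>

lemma cat_fuel_eq_0_iff:
  assumes "finite V" and "simple_graph V E" and "card E \<le> n"
  shows "cat_fuel n E v = 0 \<longleftrightarrow> \<not> (\<exists>e\<in>E. v \<in> e)"
proof (cases n)
  case 0
  then show ?thesis
    using assms simple_graph_finite_edges by fastforce
next
  case (Suc m)
  have "0 < cat_fuel n E v" if "\<exists>e\<in>E. v \<in> e"
    using that simple_graph_finite_edges[OF assms(2,1)] by (auto simp: Suc intro!: Min_gr_iff[THEN iffD2])
  then show ?thesis
    by (metis Suc cat_fuel.simps(2) neq0_conv)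
qed

text \<open>Any vertex the cat moves to still carries an edge and so has positive value. Hence score
  at most 1 means capture by the first deletion, which is possible exactly when at most one edge
  meets \<open>v\<close>.\<close>

lemma cat_fuel_le_1_iff:
  assumes V: "finite V" and G: "simple_graph V E" and n: "card E \<le> n"
  shows "cat_fuel n E v \<le> 1 \<longleftrightarrow> (\<forall>x y. {v, x} \<in> E \<longrightarrow> {v, y} \<in> E \<longrightarrow> x = y)"
proof (cases "\<exists>e\<in>E. v \<in> e")
  case False
  then show ?thesis
    using cat_fuel_eq_0_iff[OF assms, of v] by auto
next
  case True
  then obtain m where m: "n = Suc m"
    using n simple_graph_finite_edges[OF G V] by (cases n) auto
  \<comment> \<open>Every available reply costs the herder another deletion.\<close>
  have 0: "\<not> cat_fuel m (E - {e}) w \<le> 0"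
    if "e \<in> E" "w \<noteq> v" "(v, w) \<in> (adj (E - {e}))\<^sup>*" for e w
  proof -
    have "card (E - {e}) \<le> m"
      using that(1) n m by simp
    from cat_fuel_eq_0_iff[OF V simple_graph_Diff[OF G] this]
    show ?thesis using reachable_not_isolated(1)[OF that(3,2)] by simp
  qed
  have "cat_fuel n E v \<le> 1 \<longleftrightarrow>
      (\<exists>e\<in>E. \<forall>w. w \<noteq> v \<and> (v, w) \<in> (adj (E - {e}))\<^sup>* \<longrightarrow> cat_fuel m (E - {e}) w \<le> 0)"
    using True cat_fuel_Suc_le_Suc_iff[OF V G, of m v 0] unfolding m One_nat_def by blast
  also have "\<dots> \<longleftrightarrow> (\<exists>e\<in>E. \<forall>w. w \<noteq> v \<longrightarrow> (v, w) \<notin> (adj (E - {e}))\<^sup>*)"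
    using 0 by (intro bex_cong refl) blast
  also have "\<dots> \<longleftrightarrow> (\<exists>e\<in>E. \<forall>x. {v, x} \<in> E \<longrightarrow> {v, x} = e)"
  proof -
    have "(\<forall>w. w \<noteq> v \<longrightarrow> (v, w) \<notin> (adj (E - {e}))\<^sup>*) \<longleftrightarrow> (\<forall>x. {v, x} \<in> E \<longrightarrow> {v, x} = e)" for e
    proof
      assume *: "\<forall>w. w \<noteq> v \<longrightarrow> (v, w) \<notin> (adj (E - {e}))\<^sup>*"
      show "\<forall>x. {v, x} \<in> E \<longrightarrow> {v, x} = e"
      proof (intro allI impI, rule ccontr)
        fix x assume x: "{v, x} \<in> E" "{v, x} \<noteq> e"
        then have "(v, x) \<in> adj (E - {e})" "x \<noteq> v"
          using simple_graph_edgeD(1)[OF G x(1)] by (auto simp: adj_def)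
        with * show False by blast
      qed
    next
      assume *: "\<forall>x. {v, x} \<in> E \<longrightarrow> {v, x} = e"
      show "\<forall>w. w \<noteq> v \<longrightarrow> (v, w) \<notin> (adj (E - {e}))\<^sup>*"
      proof (intro allI impI notI)
        fix w assume "w \<noteq> v" "(v, w) \<in> (adj (E - {e}))\<^sup>*"
        from reachable_not_isolated(2)[OF this(2,1)]
        show False
          using * simple_graph_incident[OF G] by (metis Diff_iff singletonI)
      qed
    qed
    then show ?thesis by simp
  qed
  also have "\<dots> \<longleftrightarrow> (\<forall>x y. {v, x} \<in> E \<longrightarrow> {v, y} \<in> E \<longrightarrow> x = y)"
  proof -
    obtain u where "{v, u} \<in> E"
      using True simple_graph_incident[OF G] by metis
    moreover have "{v, x} = {v, y} \<longleftrightarrow> x = y" for x y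
      by (auto simp: doubleton_eq_iff)
    ultimately show ?thesis by metis
  qed
  finally show ?thesis .
qed

text \<open>Vacuously true for an isolated \<open>v\<close>, which covers capture by the first
  deletion.\<close>

definition star_at :: "'a set set \<Rightarrow> 'a \<Rightarrow> bool" where
  "star_at E v \<longleftrightarrow> (\<forall>w z. {v, w} \<in> E \<longrightarrow> {w, z} \<in> E \<longrightarrow> z = v)"

text \<open>In a star no walk from the centre gets beyond its neighbours, each of which has only the
  centre as neighbour. Conversely, a neighbour \<open>w\<close> of \<open>v\<close> already has
  \<open>v\<close> as a neighbour, so uniqueness leaves no other.\<close>

lemma star_at_iff_reachable_leaves:
  assumes G: "simple_graph V E"
  shows "star_at E v \<longleftrightarrow>
    (\<forall>w. w \<noteq> v \<and> (v, w) \<in> (adj E)\<^sup>* \<longrightarrow> (\<forall>x y. {w, x} \<in> E \<longrightarrow> {w, y} \<in> E \<longrightarrow> x = y))"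
    (is "_ \<longleftrightarrow> ?R")
proof
  assume star: "star_at E v"
  have "w = v \<or> {v, w} \<in> E" if "(v, w) \<in> (adj E)\<^sup>*" for w
    using that
  proof induction
    case (step y z)
    then show ?case
      using star adj_iff[OF G] unfolding star_at_def by blast
  qed simp
  then show ?R
    using star unfolding star_at_def by blast
next
  assume R: ?R
  show "star_at E v"
    unfolding star_at_def
  proof (intro allI impI)
    fix w z assume "{v, w} \<in> E" "{w, z} \<in> E"
    moreover from this have "w \<noteq> v" "(v, w) \<in> (adj E)\<^sup>*"
      using adj_iff[OF G] simple_graph_edgeD(1)[OF G] by auto
    ultimately show "z = v"
      using R by (metis insert_commute)
  qed
qed

text \<open>After the first deletion, every reply must lead to a vertex of value at most 1, that is,
  with at most one neighbour; this is the star condition.\<close>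

lemma cat_vertex_le_2_iff:
  assumes V: "finite V" and G: "simple_graph V E"
  shows "cat_vertex E v \<le> 2 \<longleftrightarrow> \<not> (\<exists>e\<in>E. v \<in> e) \<or> (\<exists>e\<in>E. star_at (E - {e}) v)"
proof (cases "\<exists>e\<in>E. v \<in> e")
  case False
  then show ?thesis
    using cat_fuel_eq_0_iff[OF V G, of "card E" v] by (auto simp: cat_vertex_def)
next
  case True
  then obtain m where m: "card E = Suc m"
    using simple_graph_finite_edges[OF G V] by (cases "card E") auto
  have "(\<forall>w. w \<noteq> v \<and> (v, w) \<in> (adj (E - {e}))\<^sup>* \<longrightarrow> cat_fuel m (E - {e}) w \<le> 1)
      \<longleftrightarrow> star_at (E - {e}) v" if "e \<in> E" for e
  proof -
    have G': "simple_graph V (E - {e})" and c: "card (E - {e}) \<le> m"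
      using simple_graph_Diff[OF G] that m by auto
    show ?thesis
      unfolding cat_fuel_le_1_iff[OF V G' c] star_at_iff_reachable_leaves[OF G'] ..
  qed
  then show ?thesis
    using True cat_fuel_Suc_le_Suc_iff[OF V G, of m v 1]
    by (auto simp: cat_vertex_def m numeral_2_eq_2 simp del: cat_fuel.simps)
qed

text \<open>The first conjunct says that the maximum is at most 2, the second that it is not at most
  1.\<close>

lemma cat_number_eq_2_iff:
  assumes V: "finite V" "V \<noteq> {}" and G: "simple_graph V E"
  shows "cat_number V E = 2 \<longleftrightarrow>
    (\<forall>v\<in>V. (\<exists>e\<in>E. v \<in> e) \<longrightarrow> (\<exists>e\<in>E. star_at (E - {e}) v)) \<and>
    (\<exists>v x y. {v, x} \<in> E \<and> {v, y} \<in> E \<and> x \<noteq> y)"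
proof -
  have "cat_number V E \<le> k \<longleftrightarrow> (\<forall>v\<in>V. cat_vertex E v \<le> k)" for k
    using V by (simp add: cat_number_def Max_le_iff)
  moreover have "cat_number V E = 2 \<longleftrightarrow> cat_number V E \<le> 2 \<and> \<not> cat_number V E \<le> 1"
    by linarith
  moreover have "(\<forall>v\<in>V. cat_vertex E v \<le> 1) \<longleftrightarrow>
      \<not> (\<exists>v x y. {v, x} \<in> E \<and> {v, y} \<in> E \<and> x \<noteq> y)"
    using cat_fuel_le_1_iff[OF V(1) G le_refl] simple_graph_edgeD(2)[OF G]
    unfolding cat_vertex_def by blast
  ultimately show ?thesis
    using cat_vertex_le_2_iff[OF V(1) G] by auto
qed

section \<open>Pruned graphs satisfying the star condition\<close>

lemma degree_eq_card_neighbours: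
  assumes "simple_graph V E"
  shows "degree E v = card {x. {v, x} \<in> E}"
proof -
  have "bij_betw (\<lambda>x. {v, x}) {x. {v, x} \<in> E} {e \<in> E. v \<in> e}"
    unfolding bij_betw_def
  proof
    show "inj_on (\<lambda>x. {v, x}) {x. {v, x} \<in> E}"
      by (auto simp: inj_on_def doubleton_eq_iff)
    show "(\<lambda>x. {v, x}) ` {x. {v, x} \<in> E} = {e \<in> E. v \<in> e}"
    proof (intro equalityI subsetI)
      fix e assume e: "e \<in> {e \<in> E. v \<in> e}"
      then obtain w where "e = {v, w}"
        using simple_graph_incident[OF assms] by blast
      with e show "e \<in> (\<lambda>x. {v, x}) ` {x. {v, x} \<in> E}" by blast
    qed blast
  qed
  then show ?thesis
    unfolding degree_def using bij_betw_same_card by fastforce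
qed

text \<open>The vertices \<open>a\<close>, \<open>b\<close>, \<open>c\<close> witness that
  \<open>v\<close> has degree at least 3; distinct leaves \<open>x\<close> and \<open>y\<close> at
  \<open>v\<close> would then form the forbidden configuration.\<close>

lemma pruned_leaves_unique:
  assumes V: "finite V" and G: "simple_graph V E" and P: "pruned V E"
    and v: "{v, a} \<in> E" "{v, b} \<in> E" "{v, c} \<in> E" "distinct [a, b, c]"
    and x: "{v, x} \<in> E" "\<forall>z. {x, z} \<in> E \<longrightarrow> z = v"
    and y: "{v, y} \<in> E" "\<forall>z. {y, z} \<in> E \<longrightarrow> z = v"
  shows "x = y"
proof (rule ccontr)
  assume "x \<noteq> y"
  have "{z. {x, z} \<in> E} = {v}" "{z. {y, z} \<in> E} = {v}"
    using x(2) y(2) x(1)[unfolded insert_commute[of v x]] y(1)[unfolded insert_commute[of v y]]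
    by blast+
  then have "degree E x = 1" "degree E y = 1"
    by (simp_all add: degree_eq_card_neighbours[OF G])
  moreover have "degree E v \<ge> 3"
  proof -
    have "{z. {v, z} \<in> E} \<subseteq> V"
      using simple_graph_edgeD(3)[OF G] by blast
    then have "card {a, b, c} \<le> degree E v"
      unfolding degree_eq_card_neighbours[OF G]
      using v V by (intro card_mono) (auto intro: finite_subset)
    then show ?thesis using v(4) by simp
  qed
  ultimately show False
    using P \<open>x \<noteq> y\<close> x(1)[unfolded insert_commute[of v x]] y(1)
      simple_graph_edgeD[OF G x(1)] simple_graph_edgeD[OF G y(1)]
    unfolding pruned_def by blast
qed

text \<open>Used to determine \<open>V\<close>: it suffices to list vertices until the list is
  closed under taking neighbours.\<close>

lemma connected_graph_closed:
  assumes "connected_graph V E" and "simple_graph V E" and "v \<in> S" "v \<in> V"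
    and closed: "\<And>x y. x \<in> S \<Longrightarrow> {x, y} \<in> E \<Longrightarrow> y \<in> S"
  shows "V \<subseteq> S"
proof
  fix w assume "w \<in> V"
  then have "(v, w) \<in> (adj E)\<^sup>*"
    using assms unfolding connected_graph_def by blast
  then show "w \<in> S"
    by induction (use assms in \<open>auto simp: adj_iff\<close>)
qed

text \<open>Deleting \<open>e\<close> affects no edge at \<open>x\<close>, so \<open>x\<close> was a
  leaf of the star already in \<open>E\<close>.\<close>

lemma star_at_Diff_leaf:
  assumes "star_at (E - {e}) v" and "{v, x} \<in> E" and "x \<notin> e"
  shows "\<forall>z. {x, z} \<in> E \<longrightarrow> z = v"
  using assms unfolding star_at_def by blast

text \<open>The path from \<open>v\<close> through \<open>x\<close> to \<open>z\<close> cannot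
  survive in a star centred at \<open>v\<close>.\<close>

lemma star_at_Diff_edge:
  assumes "star_at (E - {e}) v" and "{v, x} \<in> E" "{x, z} \<in> E" and "z \<noteq> v"
  shows "e = {v, x} \<or> e = {x, z}"
  using assms unfolding star_at_def by blast

text \<open>Neighbours of \<open>v\<close> outside the deleted edge \<open>e\<close> are leaves, and
  prunedness allows only one. So \<open>e\<close> joins two of the three neighbours, giving a
  triangle at \<open>v\<close> with a further edge, and there the star condition fails at a triangle
  vertex other than \<open>v\<close>.\<close>

lemma pruned_star_at_le_2_neighbours:
  assumes V: "finite V" and G: "simple_graph V E" and P: "pruned V E"
    and star: "\<And>v. v \<in> V \<Longrightarrow> \<exists>e\<in>E. v \<in> e \<Longrightarrow> \<exists>e\<in>E. star_at (E - {e}) v"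
    and v: "{v, a} \<in> E" "{v, b} \<in> E" "{v, c} \<in> E" "distinct [a, b, c]"
  shows False
proof -
  obtain e where e: "e \<in> E" "star_at (E - {e}) v"
    using star[of v] v(1) simple_graph_edgeD[OF G v(1)] by blast
  have two: "x \<in> e \<or> y \<in> e" if "{v, x} \<in> E" "{v, y} \<in> E" "x \<noteq> y" for x y
    using star_at_Diff_leaf[OF e(2)] pruned_leaves_unique[OF V G P v] that by metis
  \<comment> \<open>The paths \<open>a\<close>, \<open>v\<close>, \<open>c\<close> and
    \<open>a\<close>, \<open>b\<close>, \<open>v\<close> share no edge, yet a single deletion would
    have to break both.\<close>
  have tri: False if ab: "{v, a} \<in> E" "{v, b} \<in> E" "{v, c} \<in> E" "distinct [a, b, c]" "{a, b} \<in> E"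
    for a b c
  proof -
    obtain f where f: "star_at (E - {f}) a"
      using star[of a] ab(1) simple_graph_edgeD[OF G ab(1)] by blast
    have d: "a \<noteq> v" "b \<noteq> v" "c \<noteq> v"
      using ab simple_graph_edgeD(1)[OF G] by blast+
    have "f = {a, v} \<or> f = {v, c}"
      using star_at_Diff_edge[OF f, of v c] ab d by (auto simp: insert_commute)
    moreover have "f = {a, b} \<or> f = {b, v}"
      using star_at_Diff_edge[OF f, of b v] ab d by (auto simp: insert_commute)
    ultimately show False
      using d ab(4) by (auto simp: doubleton_eq_iff)
  qed
  obtain p q where pq: "e = {p, q}"
    using e(1) G unfolding simple_graph_def by blast
  \<comment> \<open>A two-element set meeting each pair taken from \<open>a\<close>,
    \<open>b\<close>, \<open>c\<close> is one of these pairs.\<close>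
  have "e = {a, b} \<or> e = {a, c} \<or> e = {b, c}"
    using two[OF v(1,2)] two[OF v(1,3)] two[OF v(2,3)] v(4) unfolding pq by auto
  then show False
    using tri[OF v] tri[OF v(1,3,2)] tri[OF v(2,3,1)] e(1) v(4) by auto
qed

text \<open>If the edge deleted for \<open>v\<close> joins its two neighbours, the graph is a
  triangle. Otherwise one neighbour is a leaf, and the graph is a path on 3 or 4 vertices according
  to whether the other neighbour has a further neighbour.\<close>

lemma pruned_star_at_cases:
  assumes V: "finite V" and G: "simple_graph V E" and P: "pruned V E"
    and star: "\<And>v. v \<in> V \<Longrightarrow> \<exists>e\<in>E. v \<in> e \<Longrightarrow> \<exists>e\<in>E. star_at (E - {e}) v"
    and v: "{v, x} \<in> E" "{v, y} \<in> E" "x \<noteq> y"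
  shows "(\<exists>a b c. distinct [a, b, c] \<and> V = {a, b, c} \<and> E = {{a, b}, {b, c}, {c, a}}) \<or>
    (\<exists>a b c. distinct [a, b, c] \<and> V = {a, b, c} \<and> E = {{a, b}, {b, c}}) \<or>
    (\<exists>a b c d. distinct [a, b, c, d] \<and> V = {a, b, c, d} \<and> E = {{a, b}, {b, c}, {c, d}})"
proof -
  have le2: "z = a \<or> z = b" if "{u, a} \<in> E" "{u, b} \<in> E" "a \<noteq> b" "{u, z} \<in> E" for u a b z
    using pruned_star_at_le_2_neighbours[OF V G P star, of u a b z] that by auto
  have C: "connected_graph V E"
    using P unfolding pruned_def by blast
  have edges: "E = F" if "\<And>p q. p \<in> V \<Longrightarrow> {p, q} \<in> E \<Longrightarrow> {p, q} \<in> F" "F \<subseteq> E" for F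
  proof
    show "E \<subseteq> F"
    proof
      fix e assume e: "e \<in> E"
      then obtain p q where "e = {p, q}" "p \<in> V"
        using G unfolding simple_graph_def by blast
      with that(1) e show "e \<in> F" by blast
    qed
  qed (rule that(2))
  obtain e where e: "e \<in> E" "star_at (E - {e}) v"
    using star[of v] v(1) simple_graph_edgeD[OF G v(1)] by blast
  show ?thesis
  proof (cases "e = {x, y}")
    case True
    have xy: "{x, y} \<in> E"
      using True e by blast
    have d: "distinct [v, x, y]"
      using v simple_graph_edgeD(1)[OF G] by auto
    have nv: "z = x \<or> z = y" if "{v, z} \<in> E" for z
      using le2[OF v that] .
    have nx: "z = v \<or> z = y" if "{x, z} \<in> E" for z
      using le2[of x v y z] v xy d that by (auto simp: insert_commute)
    have ny: "z = v \<or> z = x" if "{y, z} \<in> E" for z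
      using le2[of y v x z] v xy d that by (auto simp: insert_commute)
    have "V \<subseteq> {v, x, y}"
      using nv nx ny simple_graph_edgeD[OF G v(1)]
      by (intro connected_graph_closed[OF C G, of v]) auto
    then have VV: "V = {v, x, y}"
      using v simple_graph_edgeD[OF G] by blast
    have "E = {{v, x}, {x, y}, {y, v}}"
      using VV v xy v(2)[unfolded insert_commute[of v y]]
      by (intro edges) (auto dest!: nv nx ny)
    then show ?thesis
      using VV d by blast
  next
    case False
    \<comment> \<open>As \<open>e\<close> has two elements and differs from \<open>{x, y}\<close>,
      it misses a neighbour of \<open>v\<close>; the names are then reassigned so that
      \<open>x\<close> is a missed one.\<close>
    have "\<exists>x y. {v, x} \<in> E \<and> {v, y} \<in> E \<and> x \<noteq> y \<and> x \<notin> e"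
    proof -
      obtain p q where "e = {p, q}"
        using e(1) G unfolding simple_graph_def by blast
      then have "x \<notin> e \<or> y \<notin> e"
        using False v(3) by auto
      then show ?thesis using v by metis
    qed
    then obtain x y where v: "{v, x} \<in> E" "{v, y} \<in> E" "x \<noteq> y" and xe: "x \<notin> e"
      by blast
    have nv: "z = x \<or> z = y" if "{v, z} \<in> E" for z
      using le2[OF v that] .
    have nx: "z = v" if "{x, z} \<in> E" for z
      using star_at_Diff_leaf[OF e(2) v(1) xe] that by blast
    have d: "distinct [x, v, y]"
      using v simple_graph_edgeD(1)[OF G] by auto
    have xvy: "x \<in> V" "v \<in> V" "y \<in> V"
      using v simple_graph_edgeD[OF G] by blast+
    show ?thesis
    proof (cases "\<exists>u. {y, u} \<in> E \<and> u \<noteq> v")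
      case False
      then have ny: "z = v" if "{y, z} \<in> E" for z
        using that by blast
      have "V \<subseteq> {x, v, y}"
        using nv nx ny xvy by (intro connected_graph_closed[OF C G, of v]) auto
      then have VV: "V = {x, v, y}"
        using xvy by blast
      have "E = {{x, v}, {v, y}}"
        using VV v by (intro edges) (auto simp: insert_commute dest!: nv nx ny)
      then show ?thesis
        using VV d by blast
    next
      case True
      then obtain u where u: "{y, u} \<in> E" "u \<noteq> v" by blast
      have uV: "u \<in> V" "u \<noteq> y" "u \<noteq> x"
        using u d simple_graph_edgeD[OF G u(1)] nx[of y] by (auto simp: insert_commute)
      obtain f where f: "star_at (E - {f}) y"
        using star[OF xvy(3)] v(2) by blast
      \<comment> \<open>The deletion for a cat at \<open>y\<close> must break the path
        \<open>y\<close>, \<open>v\<close>, \<open>x\<close>. It therefore avoids \<open>u\<close>,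
        which makes \<open>u\<close> a leaf and ends the path.\<close>
      have "f = {y, v} \<or> f = {v, x}"
        using star_at_Diff_edge[OF f, of v x] v by (auto simp: insert_commute)
      then have "u \<notin> f"
        using u uV by auto
      then have nu: "z = y" if "{u, z} \<in> E" for z
        using star_at_Diff_leaf[OF f u(1)] that by blast
      have ny: "z = v \<or> z = u" if "{y, z} \<in> E" for z
        using le2[of y v u z] v u that by (auto simp: insert_commute)
      have "V \<subseteq> {x, v, y, u}"
        using nv nx ny nu xvy by (intro connected_graph_closed[OF C G, of v]) auto
      then have VV: "V = {x, v, y, u}"
        using xvy uV by blast
      have "E = {{x, v}, {v, y}, {y, u}}"
        using VV v u by (intro edges) (auto simp: insert_commute dest!: nv nx ny nu)
      moreover have "distinct [x, v, y, u]"
        using d u uV by auto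
      ultimately show ?thesis
        using VV by blast
    qed
  qed
qed

section \<open>Isomorphism with the concrete graphs\<close>

text \<open>The list tabulates the inverse isomorphism: \<open>xs ! i\<close> is the vertex sent to
  \<open>i\<close>. For a numeral \<open>n\<close>, the list quantifier unrolls into quantifiers
  over single vertices.\<close>

lemma graph_iso_iff_nth:
  assumes G: "simple_graph V E" and G': "simple_graph {0..<n} E'"
  shows "graph_iso V E {0..<n} E' \<longleftrightarrow>
    (\<exists>xs. length xs = n \<and> distinct xs \<and> V = set xs \<and> E = (\<lambda>e. (!) xs ` e) ` E')"
proof
  assume "graph_iso V E {0..<n} E'"
  then obtain f where f: "bij_betw f V {0..<n}"
    and fE: "\<And>x y. x \<in> V \<Longrightarrow> y \<in> V \<Longrightarrow> {x, y} \<in> E \<longleftrightarrow> {f x, f y} \<in> E'"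
    unfolding graph_iso_def by blast
  define g where "g = inv_into V f"
  have g: "bij_betw g {0..<n} V"
    unfolding g_def using f by (rule bij_betw_inv_into)
  have fg: "f (g i) = i" if "i < n" for i
    unfolding g_def using bij_betw_inv_into_right[OF f] that by simp
  have gf: "g (f x) = x" "f x < n" if "x \<in> V" for x
    unfolding g_def using bij_betw_inv_into_left[OF f that] bij_betwE[OF f] that by auto
  have gV: "g i \<in> V" if "i < n" for i
    using bij_betwE[OF g] that by simp
  define xs where "xs = map g [0..<n]"
  have nth: "xs ! i = g i" if "i < n" for i
    using that by (simp add: xs_def)
  have "E = (\<lambda>e. (!) xs ` e) ` E'"
  proof (intro equalityI subsetI)
    fix e assume e: "e \<in> E"
    then obtain x y where xy: "e = {x, y}" "x \<in> V" "y \<in> V"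
      using G unfolding simple_graph_def by blast
    then have "{f x, f y} \<in> E'"
      using fE e by blast
    moreover have "e = (!) xs ` {f x, f y}"
      using xy gf nth by simp
    ultimately show "e \<in> (\<lambda>e. (!) xs ` e) ` E'" by blast
  next
    fix e assume "e \<in> (\<lambda>e. (!) xs ` e) ` E'"
    then obtain e' where e': "e' \<in> E'" "e = (!) xs ` e'" by blast
    then obtain i j where "e' = {i, j}" "i < n" "j < n"
      using G' unfolding simple_graph_def by fastforce
    then show "e \<in> E"
      using e' fE[OF gV gV, of i j] fg nth by simp
  qed
  moreover have "length xs = n" "distinct xs" "V = set xs"
    using g by (auto simp: xs_def distinct_map bij_betw_def)
  ultimately show "\<exists>xs. length xs = n \<and> distinct xs \<and> V = set xs \<and> E = (\<lambda>e. (!) xs ` e) ` E'"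
    by blast
next
  assume "\<exists>xs. length xs = n \<and> distinct xs \<and> V = set xs \<and> E = (\<lambda>e. (!) xs ` e) ` E'"
  then obtain xs where xs: "length xs = n" "distinct xs" "V = set xs" "E = (\<lambda>e. (!) xs ` e) ` E'"
    by blast
  have g: "bij_betw ((!) xs) {0..<n} V"
    using xs by (auto intro: bij_betw_nth)
  define f where "f = inv_into {0..<n} ((!) xs)"
  have f: "bij_betw f V {0..<n}"
    unfolding f_def using g by (rule bij_betw_inv_into)
  have gf: "xs ! f x = x" "f x < n" if "x \<in> V" for x
    unfolding f_def using bij_betw_inv_into_right[OF g that] bij_betwE[OF f] that
    by (auto simp: f_def)
  have "{x, y} \<in> E \<longleftrightarrow> {f x, f y} \<in> E'" if "x \<in> V" "y \<in> V" for x y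
  proof -
    have "{x, y} = (!) xs ` {f x, f y}"
      using gf that by simp
    \<comment> \<open>Taking images under an injection is itself injective on sets, so non-edges are
      preserved as well.\<close>
    moreover have "(!) xs ` {f x, f y} \<in> (\<lambda>e. (!) xs ` e) ` E' \<longleftrightarrow> {f x, f y} \<in> E'"
    proof (rule inj_on_image_mem_iff)
      show "inj_on (\<lambda>e. (!) xs ` e) (Pow {0..<n})"
        using g by (auto simp: bij_betw_def intro!: inj_on_image_Pow)
      show "{f x, f y} \<in> Pow {0..<n}"
        using gf that by auto
      show "E' \<subseteq> Pow {0..<n}"
        using G' by (auto simp: simple_graph_def)
    qed
    ultimately show ?thesis
      using xs(4) by simp
  qed
  then show "graph_iso V E {0..<n} E'"
    unfolding graph_iso_def using f by blast
qed

lemma path_E_3: "path_E 3 = {{0, 1}, {1, 2}}"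
proof -
  have "path_E 3 = (\<lambda>i. {i, i + 1}) ` {i. i + 1 < 3}"
    unfolding path_E_def by blast
  also have "{i. i + 1 < (3::nat)} = {0, 1}" by auto
  finally show ?thesis by (simp add: numeral_2_eq_2)
qed

lemma path_E_4: "path_E 4 = {{0, 1}, {1, 2}, {2, 3}}"
proof -
  have "path_E 4 = (\<lambda>i. {i, i + 1}) ` {i. i + 1 < 4}"
    unfolding path_E_def by blast
  also have "{i. i + 1 < (4::nat)} = {0, 1, 2}" by auto
  finally show ?thesis by (simp add: numeral_2_eq_2 numeral_3_eq_3)
qed

lemma cycle_E_3: "cycle_E 3 = {{0, 1}, {1, 2}, {2, 0}}"
proof -
  have "cycle_E 3 = (\<lambda>i. {i, (i + 1) mod 3}) ` {i. i < 3}"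
    unfolding cycle_E_def by blast
  moreover have "{i. i < (3::nat)} = {0, 1, 2}" by auto
  ultimately have "cycle_E 3 = (\<lambda>i. {i, (i + 1) mod 3}) ` {0, 1, 2}"
    by (simp only:)
  then show ?thesis by (simp, simp add: numeral_2_eq_2)
qed

lemma simple_graph_insert:
  "simple_graph V {}"
  "simple_graph V (insert {x, y} E) \<longleftrightarrow> x \<noteq> y \<and> x \<in> V \<and> y \<in> V \<and> simple_graph V E"
  unfolding simple_graph_def by simp (simp add: doubleton_eq_iff, blast)

lemma ex_length_Suc_conv:
  "(\<exists>xs. length xs = Suc n \<and> P xs) \<longleftrightarrow> (\<exists>x xs. length xs = n \<and> P (x # xs))"
  by (auto simp: length_Suc_conv)

lemma graph_iso_path_3_iff:
  assumes "simple_graph V E"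
  shows "graph_iso V E (path_V 3) (path_E 3) \<longleftrightarrow>
    (\<exists>a b c. distinct [a, b, c] \<and> V = {a, b, c} \<and> E = {{a, b}, {b, c}})"
proof -
  have "simple_graph {0..<3} (path_E 3)"
    by (simp add: path_E_3 simple_graph_insert)
  from graph_iso_iff_nth[OF assms this] show ?thesis
    unfolding path_V_def path_E_3
    by (simp add: numeral_eq_Suc ex_length_Suc_conv)
qed

lemma graph_iso_path_4_iff:
  assumes "simple_graph V E"
  shows "graph_iso V E (path_V 4) (path_E 4) \<longleftrightarrow>
    (\<exists>a b c d. distinct [a, b, c, d] \<and> V = {a, b, c, d} \<and> E = {{a, b}, {b, c}, {c, d}})"
proof -
  have "simple_graph {0..<4} (path_E 4)"
    by (simp add: path_E_4 simple_graph_insert)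
  from graph_iso_iff_nth[OF assms this] show ?thesis
    unfolding path_V_def path_E_4
    by (simp add: numeral_eq_Suc ex_length_Suc_conv)
qed

lemma graph_iso_cycle_3_iff:
  assumes "simple_graph V E"
  shows "graph_iso V E (cycle_V 3) (cycle_E 3) \<longleftrightarrow>
    (\<exists>a b c. distinct [a, b, c] \<and> V = {a, b, c} \<and> E = {{a, b}, {b, c}, {c, a}})"
proof -
  have "simple_graph {0..<3} (cycle_E 3)"
    by (simp add: cycle_E_3 simple_graph_insert)
  from graph_iso_iff_nth[OF assms this] show ?thesis
    unfolding cycle_V_def cycle_E_3
    by (simp add: numeral_eq_Suc ex_length_Suc_conv)
qed

theorem mainTheorem6:
  fixes V :: "'a set" and E :: "'a set set"
  assumes "finite V" and "simple_graph V E" and "pruned V E"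
  shows "cat_number V E = 2 \<longleftrightarrow>
           (graph_iso V E (cycle_V 3) (cycle_E 3) \<or>
            graph_iso V E (path_V 3) (path_E 3) \<or>
            graph_iso V E (path_V 4) (path_E 4))"
proof -
  have "V \<noteq> {}"
    using assms(3) unfolding pruned_def connected_graph_def by blast
  note cat = cat_number_eq_2_iff[OF assms(1) this assms(2)]
  note iso = graph_iso_cycle_3_iff[OF assms(2)] graph_iso_path_3_iff[OF assms(2)]
    graph_iso_path_4_iff[OF assms(2)]
  have cat2: "cat_number V E = 2"
    if "\<forall>u\<in>V. \<exists>e\<in>E. star_at (E - {e}) u" "{v, x} \<in> E" "{v, y} \<in> E" "x \<noteq> y" for v x y
    unfolding cat using that by blast
  show ?thesis
  proof
    assume "cat_number V E = 2"
    then obtain v x y where v: "{v, x} \<in> E" "{v, y} \<in> E" "x \<noteq> y"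
      and star: "\<And>v. v \<in> V \<Longrightarrow> \<exists>e\<in>E. v \<in> e \<Longrightarrow> \<exists>e\<in>E. star_at (E - {e}) v"
      unfolding cat by blast
    show "graph_iso V E (cycle_V 3) (cycle_E 3) \<or> graph_iso V E (path_V 3) (path_E 3) \<or>
        graph_iso V E (path_V 4) (path_E 4)"
      unfolding iso using pruned_star_at_cases[OF assms star v] .
  next
    assume "graph_iso V E (cycle_V 3) (cycle_E 3) \<or> graph_iso V E (path_V 3) (path_E 3) \<or>
        graph_iso V E (path_V 4) (path_E 4)"
    then consider
      (C3) a b c where "distinct [a, b, c]" "V = {a, b, c}" "E = {{a, b}, {b, c}, {c, a}}"
      | (P3) a b c where "distinct [a, b, c]" "V = {a, b, c}" "E = {{a, b}, {b, c}}"
      | (P4) a b c d where "distinct [a, b, c, d]" "V = {a, b, c, d}" "E = {{a, b}, {b, c}, {c, d}}"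
      unfolding iso by (elim disjE exE conjE) (erule (2) that)+
    then show "cat_number V E = 2"
    proof cases
      case C3
      \<comment> \<open>The herder deletes the edge opposite the cat.\<close>
      then have "star_at (E - {{b, c}}) a" "star_at (E - {{c, a}}) b" "star_at (E - {{a, b}}) c"
        by (auto simp: star_at_def doubleton_eq_iff)
      moreover have E: "{a, b} \<in> E" "{a, c} \<in> E" "{c, a} \<in> E" "{b, c} \<in> E" "b \<noteq> c"
        using C3 by auto
      ultimately have "\<forall>u\<in>V. \<exists>e\<in>E. star_at (E - {e}) u"
        unfolding C3(2) by blast
      from cat2[OF this E(1,2,5)] show ?thesis .
    next
      case P3
      \<comment> \<open>At an end the cat is isolated at once; at \<open>b\<close> a single edge
        remains.\<close>
      then have "star_at (E - {{a, b}}) a" "star_at (E - {{a, b}}) b" "star_at (E - {{b, c}}) c"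
        by (auto simp: star_at_def doubleton_eq_iff)
      moreover have E: "{a, b} \<in> E" "{b, a} \<in> E" "{b, c} \<in> E" "a \<noteq> c"
        using P3 by auto
      ultimately have "\<forall>u\<in>V. \<exists>e\<in>E. star_at (E - {e}) u"
        unfolding P3(2) by blast
      from cat2[OF this E(2-4)] show ?thesis .
    next
      case P4
      \<comment> \<open>Ends are isolated at once; for inner vertices, deleting the middle edge
        leaves the cat on a single edge.\<close>
      then have "star_at (E - {{a, b}}) a" "star_at (E - {{b, c}}) b"
        "star_at (E - {{b, c}}) c" "star_at (E - {{c, d}}) d"
        by (auto simp: star_at_def doubleton_eq_iff)
      moreover have E: "{a, b} \<in> E" "{b, a} \<in> E" "{b, c} \<in> E" "{c, d} \<in> E" "a \<noteq> c"
        using P4 by auto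
      ultimately have "\<forall>u\<in>V. \<exists>e\<in>E. star_at (E - {e}) u"
        unfolding P4(2) by blast
      from cat2[OF this E(2,3,5)] show ?thesis .
    qed
  qed
qed

end
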